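(* For every integer $r\ge4$, the third type of triangular hex derived network $G=THDN3(r)$ satisfies $$ReZG_1(G)=\frac{3}{154}\,(3408-5117r+2009r^2),$$ $$ReZG_2(G)=\frac12\,(6-11r+7r^2),$$ $$ReZG_3(G)=24\,(6192-5185r+1141r^2).$$
   Context: All graphs are finite, simple and undirected; $\kappa(p)$ denotes the degree of a vertex $p$ in a graph $G$. Triangular mesh of dimension $r$: the graph whose vertices are the triples $(x,y,z)$ of nonnegative integers with $x+y+z=r-1$, two vertices being adjacent iff their difference is a permutation of $(1,-1,0)$ (a triangular piece of the triangular lattice with $r$ vertices on each side). Third type of triangular hex derived network $THDN3(r)$: obtained from the triangular mesh of dimension $r$ by replacing each $K_3$ subgraph (triangle) by a planar octahedron, once. That is, for each triangle with vertices $a,b,c$, all edges of the triangle are kept, three new vertices $u_{ab},u_{bc},u_{ca}$ (private to that triangle) are added, the new vertices are made pairwise adjacent, and $u_{ab}$ is joined to $a$ and $b$, $u_{bc}$ to $b$ and $c$, $u_{ca}$ to $c$ and $a$. It has $\frac{7r^2-11r+6}{2}$ vertices. Redefined Zagreb indices (with the convention used here): $$ReZG_1(G)=\sum_{pq\in E(G)}\frac{\kappa(p)\kappa(q)}{\kappa(p)+\kappa(q)},\qquad ReZG_2(G)=\sum_{pq\in E(G)}\frac{\kappa(p)+\kappa(q)}{\kappa(p)\kappa(q)},$$ $$ReZG_3(G)=\sum_{pq\in E(G)}\kappa(p)\kappa(q)\big(\kappa(p)+\kappa(q)\big).$$ *)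

theory Defs
  imports Complex_Main
begin

text \<open>An undirected graph has a set of vertices and a set of edges, each edge being the
  set of its two endpoints.\<close>

record 'a ugraph =
  verts :: "'a set"
  edges :: "'a set set"

definition simple_graph :: "'a ugraph \<Rightarrow> bool" where
  "simple_graph G \<longleftrightarrow> finite (verts G) \<and> (\<forall>e\<in>edges G. e \<subseteq> verts G \<and> card e = 2)"

definition degree :: "'a ugraph \<Rightarrow> 'a \<Rightarrow> nat" where
  "degree G v = card {e \<in> edges G. v \<in> e}"

text \<open>The redefined Zagreb indices. An edge \<open>e = {p, q}\<close> has exactly two elements, so
  \<open>\<Prod>p\<in>e\<close> and \<open>\<Sum>p\<in>e\<close> give the product and the sum of the degrees of its endpoints.
  Note that part of the literature interchanges the names of the first two indices.\<close>

definition ReZG1 :: "'a ugraph \<Rightarrow> real" where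
  "ReZG1 G = (\<Sum>e\<in>edges G. (\<Prod>p\<in>e. real (degree G p)) / (\<Sum>p\<in>e. real (degree G p)))"

definition ReZG2 :: "'a ugraph \<Rightarrow> real" where
  "ReZG2 G = (\<Sum>e\<in>edges G. (\<Sum>p\<in>e. real (degree G p)) / (\<Prod>p\<in>e. real (degree G p)))"

definition ReZG3 :: "'a ugraph \<Rightarrow> real" where
  "ReZG3 G = (\<Sum>e\<in>edges G. (\<Prod>p\<in>e. real (degree G p)) * (\<Sum>p\<in>e. real (degree G p)))"

definition mesh_adj :: "nat \<times> nat \<times> nat \<Rightarrow> nat \<times> nat \<times> nat \<Rightarrow> bool" where
  "mesh_adj = (\<lambda>(x, y, z) (x', y', z').
     (int x - int x', int y - int y', int z - int z') \<in>
       {(1, -1, 0), (1, 0, -1), (0, 1, -1), (0, -1, 1), (-1, 0, 1), (-1, 1, 0)})"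

definition mesh_verts :: "nat \<Rightarrow> (nat \<times> nat \<times> nat) set" where
  "mesh_verts r = {(x, y, z). x + y + z + 1 = r}"

definition tri_mesh :: "nat \<Rightarrow> (nat \<times> nat \<times> nat) ugraph" where
  "tri_mesh r =
     \<lparr>verts = mesh_verts r,
      edges = {{p, q} | p q. p \<in> mesh_verts r \<and> q \<in> mesh_verts r \<and> mesh_adj p q}\<rparr>"

definition triangles :: "'a ugraph \<Rightarrow> 'a set set" where
  "triangles G = {T. T \<subseteq> verts G \<and> card T = 3 \<and>
                     (\<forall>a\<in>T. \<forall>b\<in>T. a \<noteq> b \<longrightarrow> {a, b} \<in> edges G)}"

text \<open>\<open>New T {a, b}\<close> is the vertex \<open>u\<^sub>a\<^sub>b\<close> private to the triangle \<open>T\<close>; an edge shared by two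
  triangles therefore yields two different new vertices.\<close>

datatype 'a oct_vertex = Old 'a | New "'a set" "'a set"

definition new_verts :: "'a set \<Rightarrow> 'a oct_vertex set" where
  "new_verts T = {New T e | e. e \<subseteq> T \<and> card e = 2}"

definition octahedral_replacement :: "'a ugraph \<Rightarrow> 'a oct_vertex ugraph" where
  "octahedral_replacement G =
     \<lparr>verts = Old ` verts G \<union> (\<Union>T\<in>triangles G. new_verts T),
      edges = {{Old a, Old b} | a b. {a, b} \<in> edges G}
        \<union> (\<Union>T\<in>triangles G. {{u, v} | u v. u \<in> new_verts T \<and> v \<in> new_verts T \<and> u \<noteq> v})
        \<union> (\<Union>T\<in>triangles G. {{New T e, Old a} | e a. e \<subseteq> T \<and> card e = 2 \<and> a \<in> e})\<rparr>"

definition THDN3 :: "nat \<Rightarrow> (nat \<times> nat \<times> nat) oct_vertex ugraph" where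
  "THDN3 r = octahedral_replacement (tri_mesh r)"

lemma simple_graph_tri_mesh: "simple_graph (tri_mesh r)"
proof -
  have "mesh_verts r \<subseteq> {..r} \<times> {..r} \<times> {..r}"
    by (auto simp: mesh_verts_def)
  then have "finite (mesh_verts r)"
    by (rule finite_subset) auto
  moreover have "card {p, q} = 2" if "mesh_adj p q" for p q
  proof -
    have "p \<noteq> q"
      using that by (auto simp: mesh_adj_def)
    then show ?thesis
      by simp
  qed
  ultimately show ?thesis
    unfolding simple_graph_def tri_mesh_def by fastforce
qed

lemma simple_graph_octahedral_replacement:
  assumes "simple_graph G"
  shows "simple_graph (octahedral_replacement G)"
proof -
  have fin: "finite (verts G)" and edge: "\<And>e. e \<in> edges G \<Longrightarrow> e \<subseteq> verts G \<and> card e = 2"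
    using assms by (auto simp: simple_graph_def)
  have "triangles G \<subseteq> Pow (verts G)"
    by (auto simp: triangles_def)
  then have "finite (triangles G)"
    using fin by (meson finite_Pow_iff finite_subset)
  moreover have "finite (new_verts T)" if "T \<in> triangles G" for T
  proof -
    have "finite T"
      using that fin by (auto simp: triangles_def intro: finite_subset)
    moreover have "new_verts T \<subseteq> New T ` Pow T"
      by (auto simp: new_verts_def)
    ultimately show ?thesis
      by (meson finite_Pow_iff finite_imageI finite_subset)
  qed
  ultimately have "finite (verts (octahedral_replacement G))"
    using fin by (auto simp: octahedral_replacement_def)
  moreover have "e \<subseteq> verts (octahedral_replacement G) \<and> card e = 2"
    if e: "e \<in> edges (octahedral_replacement G)" for e
  proof -
    consider (old) a b where "e = {Old a, Old b}" "{a, b} \<in> edges G"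
      | (new) T u v where "T \<in> triangles G" "e = {u, v}" "u \<in> new_verts T" "v \<in> new_verts T" "u \<noteq> v"
      | (mixed) T f a where "T \<in> triangles G" "e = {New T f, Old a}" "f \<subseteq> T" "card f = 2" "a \<in> f"
      using e unfolding octahedral_replacement_def by simp blast
    then show ?thesis
    proof cases
      case old
      then have "{a, b} \<subseteq> verts G" "card {a, b} = 2"
        using edge by blast+
      then show ?thesis
        using old by (auto simp: octahedral_replacement_def card_insert_if split: if_splits)
    next
      case new
      then show ?thesis
        by (auto simp: octahedral_replacement_def)
    next
      case mixed
      then have "a \<in> verts G"
        by (auto simp: triangles_def)
      then show ?thesis
        using mixed by (auto simp: octahedral_replacement_def new_verts_def)
    qed
  qed
  ultimately show ?thesis
    by (auto simp: simple_graph_def)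
qed

lemma simple_graph_THDN3: "simple_graph (THDN3 r)"
  by (simp add: THDN3_def simple_graph_octahedral_replacement simple_graph_tri_mesh)

end

theory Submission imports Defs begin

text \<open>
  All three indices have the form \<open>\<Sum>e. \<phi> (product of the end degrees) (sum of the end degrees)\<close>
  for some function \<open>\<phi>\<close>, so it is enough to know how many edges of the network have each pair of end
  degrees. This is done for an arbitrary \<open>\<phi>\<close>.

  In the octahedral replacement of any simple graph a new vertex has degree 4, and an old vertex \<open>a\<close>
  gains two neighbours in each triangle through it. Each triangle contributes three edges between
  new vertices, which is one for each of its corners, and two edges from each corner to new
  vertices. Summed over the triangles, these contributions become a sum over the old vertices
  weighted by the number of triangles through the vertex. This is
  \<open>zagreb_sum_octahedral_replacement\<close>.

  In the triangular mesh the degree of a vertex and the number of triangles through it depend only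
  on which of its barycentric coordinates vanish: an old vertex has degree 18, 10 or 4 in the network
  if it lies in the interior, inside a side or at a corner. For the edges that are
  kept, observe that every mesh edge lies in exactly one upward triangle. The upward triangles
  are indexed by the vertices of the mesh with one vertex less on each side, and the degrees at
  the ends of their edges depend only on the zero pattern of that index. So both remaining sums run over
  the vertices of a mesh and have summands determined by the zero pattern; \<open>sum_zero_pattern\<close>
  evaluates every such sum.
\<close>

section \<open>Pairs and neighbours\<close>

lemma card_pairs_through:
  assumes "finite T" "a \<in> T"
  shows "card {e. e \<subseteq> T \<and> card e = 2 \<and> a \<in> e} = card T - 1"
proof -
  have "\<exists>b. b \<noteq> a \<and> e = {a, b}" if "card e = 2" "a \<in> e" for e
    using that unfolding card_2_iff by (metis insert_commute insertE singletonD)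
  then have "{e. e \<subseteq> T \<and> card e = 2 \<and> a \<in> e} = (\<lambda>b. {a, b}) ` (T - {a})"
    using assms(2) by fastforce
  moreover have "inj_on (\<lambda>b. {a, b}) (T - {a})"
    by (auto simp: inj_on_def doubleton_eq_iff)
  ultimately show ?thesis
    using assms by (simp add: card_image)
qed

lemma degree_eq_card_neighbours:
  assumes "simple_graph G"
  shows "degree G v = card {w. {v, w} \<in> edges G}"
proof -
  have "bij_betw (\<lambda>w. {v, w}) {w. {v, w} \<in> edges G} {e \<in> edges G. v \<in> e}"
    unfolding bij_betw_def
  proof
    show "inj_on (\<lambda>w. {v, w}) {w. {v, w} \<in> edges G}"
      by (auto simp: inj_on_def doubleton_eq_iff)
    have "\<exists>w. e = {v, w}" if "e \<in> edges G" "v \<in> e" for e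
      using that assms by (fastforce simp: simple_graph_def card_2_iff)
    then show "(\<lambda>w. {v, w}) ` {w. {v, w} \<in> edges G} = {e \<in> edges G. v \<in> e}"
      by fastforce
  qed
  then show ?thesis
    by (simp add: degree_def bij_betw_same_card)
qed

section \<open>Octahedral replacement of a simple graph\<close>

lemma finite_edges: "simple_graph G \<Longrightarrow> finite (edges G)"
  by (rule finite_subset[of _ "Pow (verts G)"]) (auto simp: simple_graph_def)

lemma finite_triangles: "simple_graph G \<Longrightarrow> finite (triangles G)"
  by (rule finite_subset[of _ "Pow (verts G)"]) (auto simp: simple_graph_def triangles_def)

lemma triangleD:
  assumes "T \<in> triangles G"
  shows "T \<subseteq> verts G" "card T = 3" "finite T"
  using assms by (auto simp: triangles_def intro: card_ge_0_finite)

lemma new_verts_image: "new_verts T = New T ` {e. e \<subseteq> T \<and> card e = 2}"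
  by (auto simp: new_verts_def)

lemma card_new_verts:
  assumes "T \<in> triangles G"
  shows "card (new_verts T) = 3" "finite (new_verts T)"
proof -
  have "card {e. e \<subseteq> T \<and> card e = 2} = 3"
    using triangleD[OF assms] by (simp add: n_subsets choose_two)
  then show "card (new_verts T) = 3"
    unfolding new_verts_image by (subst card_image) (auto simp: inj_on_def)
  then show "finite (new_verts T)"
    by (intro card_ge_0_finite) simp
qed

lemma edges_octahedral_replacement:
  "edges (octahedral_replacement G) =
     {{Old a, Old b} | a b. {a, b} \<in> edges G}
     \<union> (\<Union>T\<in>triangles G. {{u, v} | u v. u \<in> new_verts T \<and> v \<in> new_verts T \<and> u \<noteq> v})
     \<union> (\<Union>T\<in>triangles G. {{New T e, Old a} | e a. e \<subseteq> T \<and> card e = 2 \<and> a \<in> e})"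
  by (simp add: octahedral_replacement_def)

text \<open>The neighbours of \<open>u\<^sub>a\<^sub>b\<close> are the other two new vertices of its triangle and \<open>a\<close>, \<open>b\<close>.\<close>

lemma degree_New:
  assumes G: "simple_graph G" and T: "T \<in> triangles G" and e: "e \<subseteq> T" "card e = 2"
  shows "degree (octahedral_replacement G) (New T e) = 4"
proof -
  have new_new: "{New T e, New T' e'} \<in> edges (octahedral_replacement G) \<longleftrightarrow>
      T' = T \<and> e' \<subseteq> T \<and> card e' = 2 \<and> e' \<noteq> e" for T' e'
    using T e unfolding edges_octahedral_replacement new_verts_def
    by (simp add: doubleton_eq_iff) blast
  have new_old: "{New T e, Old a} \<in> edges (octahedral_replacement G) \<longleftrightarrow> a \<in> e" for a
    using T e unfolding edges_octahedral_replacement new_verts_def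
    by (simp add: doubleton_eq_iff) blast
  have "{w. {New T e, w} \<in> edges (octahedral_replacement G)} = (new_verts T - {New T e}) \<union> Old ` e"
    using T e unfolding set_eq_iff mem_Collect_eq
    by (intro allI, rename_tac w, case_tac w) (auto simp: new_new new_old new_verts_def)
  moreover have "card (new_verts T - {New T e}) = 2"
    using card_new_verts[OF T] e by (subst card_Diff_singleton) (auto simp: new_verts_def)
  moreover have "card (Old ` e) = 2" "finite (Old ` e)"
    using e by (auto simp: card_image inj_on_def intro: card_ge_0_finite)
  moreover have "(new_verts T - {New T e}) \<inter> Old ` e = {}"
    by (auto simp: new_verts_def)
  ultimately show ?thesis
    using card_new_verts[OF T]
    by (simp add: degree_eq_card_neighbours[OF simple_graph_octahedral_replacement[OF G]]
        card_Un_disjoint)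
qed

text \<open>A triangle through \<open>a\<close> has two sides through \<open>a\<close>, and each of them gives a new neighbour. Different
  triangles give different ones because new vertices are private to their triangle.\<close>

lemma degree_Old:
  assumes G: "simple_graph G"
  shows "degree (octahedral_replacement G) (Old a) = degree G a + 2 * card {T \<in> triangles G. a \<in> T}"
proof -
  let ?S = "{T \<in> triangles G. a \<in> T}"
  let ?P = "\<lambda>T. {e. e \<subseteq> T \<and> card e = 2 \<and> a \<in> e}"
  let ?N = "{b. {a, b} \<in> edges G}"
  have nb: "{w. {Old a, w} \<in> edges (octahedral_replacement G)} = Old ` ?N \<union> (\<Union>T\<in>?S. New T ` ?P T)"
    unfolding edges_octahedral_replacement
    by (auto simp: new_verts_def doubleton_eq_iff insert_commute)
  have fS: "finite ?S"
    using finite_triangles[OF G] by simp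
  have fP: "finite (?P T)" if "T \<in> ?S" for T
    using triangleD[of T G] that by simp
  have "?N \<subseteq> verts G"
    using G by (auto simp: simple_graph_def)
  then have fN: "finite ?N"
    using G finite_subset by (auto simp: simple_graph_def)
  have "card (\<Union>T\<in>?S. New T ` ?P T) = (\<Sum>T\<in>?S. card (New T ` ?P T))"
    using fS fP by (intro card_UN_disjoint) auto
  also have "\<dots> = (\<Sum>T\<in>?S. 2)"
  proof (rule sum.cong)
    fix T assume "T \<in> ?S"
    then show "card (New T ` ?P T) = 2"
      using card_pairs_through[of T a] triangleD[of T G] by (simp add: card_image inj_on_def)
  qed simp
  finally have "card (\<Union>T\<in>?S. New T ` ?P T) = 2 * card ?S"
    by simp
  moreover have "card (Old ` ?N) = degree G a"
    by (simp add: degree_eq_card_neighbours[OF G] card_image inj_on_def)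
  ultimately show ?thesis
    unfolding degree_eq_card_neighbours[OF simple_graph_octahedral_replacement[OF G]] nb
    using fS fP fN by (subst card_Un_disjoint) auto
qed

text \<open>The indices \<open>ReZG1\<close>, \<open>ReZG2\<close> and \<open>ReZG3\<close> are the instances in which \<open>\<phi> p s\<close> is \<open>p / s\<close>, \<open>s / p\<close> and
  \<open>p * s\<close>.\<close>

definition zagreb_sum :: "(real \<Rightarrow> real \<Rightarrow> real) \<Rightarrow> 'a ugraph \<Rightarrow> real" where
  "zagreb_sum \<phi> G =
     (\<Sum>e\<in>edges G. \<phi> (\<Prod>p\<in>e. real (degree G p)) (\<Sum>p\<in>e. real (degree G p)))"

text \<open>Double counting of the pairs of a triangle and one of its corners.\<close>

lemma sum_triangles_corners:
  fixes h :: "'a \<Rightarrow> real"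
  assumes "simple_graph G"
  shows "(\<Sum>T\<in>triangles G. \<Sum>a\<in>T. h a) = (\<Sum>a\<in>verts G. real (card {T \<in> triangles G. a \<in> T}) * h a)"
proof -
  have "(\<Sum>T\<in>triangles G. \<Sum>a\<in>T. h a) = (\<Sum>T\<in>triangles G. \<Sum>a\<in>{a \<in> verts G. a \<in> T}. h a)"
    using triangleD(1) by (intro sum.cong) auto
  also have "\<dots> = (\<Sum>a\<in>verts G. \<Sum>T\<in>{T \<in> triangles G. a \<in> T}. h a)"
    using assms finite_triangles[OF assms] by (intro sum.swap_restrict) (auto simp: simple_graph_def)
  finally show ?thesis
    by simp
qed

text \<open>An edge between two new vertices has product 16 and sum 8. The three such edges of a triangle
  are shared out among its three corners, which gives the term \<open>\<phi> 16 8\<close>; the factor 2 counts the edges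
  that join a corner to the new vertices of the triangle.\<close>

lemma zagreb_sum_octahedral_replacement:
  fixes G :: "'a ugraph"
  assumes G: "simple_graph G"
  defines "D \<equiv> \<lambda>a. real (degree (octahedral_replacement G) (Old a))"
  shows "zagreb_sum \<phi> (octahedral_replacement G) =
           (\<Sum>e\<in>edges G. \<phi> (\<Prod>p\<in>e. D p) (\<Sum>p\<in>e. D p)) +
           (\<Sum>a\<in>verts G. real (card {T \<in> triangles G. a \<in> T}) *
              (\<phi> 16 8 + 2 * \<phi> (4 * D a) (4 + D a)))"
proof -
  define H where "H = octahedral_replacement G"
  define \<psi> where "\<psi> = (\<lambda>e. \<phi> (\<Prod>p\<in>e. real (degree H p)) (\<Sum>p\<in>e. real (degree H p)))"
  \<comment> \<open>\<open>A\<close> holds the edges of \<open>G\<close>, \<open>B T\<close> the edges among the new vertices of \<open>T\<close>, and \<open>C T\<close> the edges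
     between the corners of \<open>T\<close> and its new vertices.\<close>
  define A where "A = (`) Old ` edges G"
  define B :: "'a set \<Rightarrow> 'a oct_vertex set set" where "B T = {s. s \<subseteq> new_verts T \<and> card s = 2}" for T
  define P where "P T a = {e. e \<subseteq> T \<and> card e = 2 \<and> a \<in> e}" for T :: "'a set" and a
  define C where "C T = (\<lambda>(a, e). {New T e, Old a}) ` Sigma T (P T)" for T
  note tri = triangleD[of _ G] and new = card_new_verts[of _ G]
  have fT: "finite (triangles G)"
    by (rule finite_triangles[OF G])
  have fB: "finite (B T)" if "T \<in> triangles G" for T
    using new[OF that] by (simp add: B_def)
  have fP: "finite (P T a)" if "T \<in> triangles G" for T a
    using tri[OF that] by (simp add: P_def)
  have fC: "finite (C T)" if "T \<in> triangles G" for T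
    using tri[OF that] fP[OF that] by (simp add: C_def)
  have A: "{{Old a, Old b} | a b. {a, b} \<in> edges G} = A"
  proof -
    have "\<exists>a b. e = {a, b}" if "e \<in> edges G" for e
      using that G card_2_iff[of e] unfolding simple_graph_def by metis
    then have "edges G = {{a, b} | a b. {a, b} \<in> edges G}"
      by blast
    then have "A = {Old ` {a, b} | a b. {a, b} \<in> edges G}"
      unfolding A_def by (subst \<open>edges G = _\<close>) blast
    then show ?thesis
      by simp
  qed
  have B: "{{u, v} | u v. u \<in> new_verts T \<and> v \<in> new_verts T \<and> u \<noteq> v} = B T" for T :: "'a set"
    by (auto simp: B_def card_2_iff)
  have C: "{{New T e, Old a} | e a. e \<subseteq> T \<and> card e = 2 \<and> a \<in> e} = C T" for T
    by (fastforce simp: C_def P_def)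
  have E: "edges H = A \<union> (\<Union>T\<in>triangles G. B T) \<union> (\<Union>T\<in>triangles G. C T)"
    unfolding H_def edges_octahedral_replacement A B C ..
  have AB: "A \<inter> (\<Union>T\<in>triangles G. B T) = {}"
  proof -
    have "s \<notin> B T" if "s \<in> A" for s T
    proof
      assume "s \<in> B T"
      then have "s \<noteq> {}" "s \<subseteq> new_verts T"
        by (auto simp: B_def)
      then show False
        using that by (auto simp: A_def new_verts_def)
    qed
    then show ?thesis by auto
  qed
  have AC: "(A \<union> (\<Union>T\<in>triangles G. B T)) \<inter> (\<Union>T\<in>triangles G. C T) = {}"
    by (auto simp: A_def B_def C_def new_verts_def)
  have BB: "B T \<inter> B T' = {}" if "T \<noteq> T'" for T T'
  proof -
    have disj: "new_verts T \<inter> new_verts T' = {}"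
      using that by (auto simp: new_verts_def)
    have False if "s \<in> B T" "s \<in> B T'" for s
    proof -
      have "s \<subseteq> new_verts T \<inter> new_verts T'" "card s = 2"
        using that by (auto simp: B_def)
      then show False
        using disj by simp
    qed
    then show ?thesis
      by blast
  qed
  have CC: "C T \<inter> C T' = {}" if "T \<noteq> T'" for T T'
    using that by (auto simp: C_def doubleton_eq_iff)
  have dN: "real (degree H u) = 4" if "T \<in> triangles G" "u \<in> new_verts T" for T u
    using that degree_New[OF G] by (auto simp: H_def new_verts_def)
  have sumA: "(\<Sum>e\<in>A. \<psi> e) = (\<Sum>e\<in>edges G. \<phi> (\<Prod>p\<in>e. D p) (\<Sum>p\<in>e. D p))"
  proof -
    have "inj_on ((`) Old) (edges G)"
      by (rule inj_onI) (simp add: inj_image_eq_iff inj_def)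
    then have "(\<Sum>e\<in>A. \<psi> e) = (\<Sum>e\<in>edges G. \<psi> (Old ` e))"
      unfolding A_def by (simp add: sum.reindex)
    moreover have "\<psi> (Old ` e) = \<phi> (\<Prod>p\<in>e. D p) (\<Sum>p\<in>e. D p)" for e
      by (simp add: \<psi>_def D_def H_def prod.reindex sum.reindex inj_on_def)
    ultimately show ?thesis by simp
  qed
  have sumB: "(\<Sum>e\<in>B T. \<psi> e) = (\<Sum>a\<in>T. \<phi> 16 8)" if T: "T \<in> triangles G" for T
  proof -
    have "\<psi> e = \<phi> 16 8" if e: "e \<in> B T" for e
    proof -
      obtain u v where "e = {u, v}" "u \<noteq> v" "u \<in> new_verts T" "v \<in> new_verts T"
        using e by (auto simp: B_def card_2_iff)
      then show ?thesis
        using dN[OF T] by (simp add: \<psi>_def)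
    qed
    moreover have "card (B T) = 3"
      unfolding B_def using new[OF T] by (simp add: n_subsets choose_two)
    ultimately show ?thesis
      using tri[OF T] by simp
  qed
  have sumC: "(\<Sum>e\<in>C T. \<psi> e) = (\<Sum>a\<in>T. 2 * \<phi> (4 * D a) (4 + D a))" if T: "T \<in> triangles G" for T
  proof -
    have "(\<Sum>e\<in>C T. \<psi> e) = (\<Sum>(a, e)\<in>Sigma T (P T). \<psi> {New T e, Old a})"
      unfolding C_def
      by (subst sum.reindex) (auto simp: inj_on_def doubleton_eq_iff case_prod_unfold)
    also have "\<dots> = (\<Sum>a\<in>T. \<Sum>e\<in>P T a. \<psi> {New T e, Old a})"
      using tri[OF T] fP[OF T] by (subst sum.Sigma) auto
    also have "\<dots> = (\<Sum>a\<in>T. \<Sum>e\<in>P T a. \<phi> (4 * D a) (4 + D a))"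
    proof (intro sum.cong refl)
      fix a e assume "e \<in> P T a"
      then have "real (degree H (New T e)) = 4"
        by (intro dN[OF T]) (auto simp: P_def new_verts_def)
      then show "\<psi> {New T e, Old a} = \<phi> (4 * D a) (4 + D a)"
        by (simp add: \<psi>_def D_def H_def)
    qed
    also have "\<dots> = (\<Sum>a\<in>T. 2 * \<phi> (4 * D a) (4 + D a))"
      using tri[OF T] by (intro sum.cong) (auto simp: P_def card_pairs_through)
    finally show ?thesis .
  qed
  have "zagreb_sum \<phi> H = (\<Sum>e\<in>edges H. \<psi> e)"
    by (simp add: zagreb_sum_def \<psi>_def)
  also have "\<dots> = (\<Sum>e\<in>A. \<psi> e) + (\<Sum>e\<in>(\<Union>T\<in>triangles G. B T). \<psi> e) + (\<Sum>e\<in>(\<Union>T\<in>triangles G. C T). \<psi> e)"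
    unfolding E using fT fB fC AB AC finite_edges[OF G]
    by (simp add: sum.union_disjoint A_def)
  also have "(\<Sum>e\<in>(\<Union>T\<in>triangles G. B T). \<psi> e) = (\<Sum>T\<in>triangles G. \<Sum>a\<in>T. \<phi> 16 8)"
    using fT fB BB sumB by (subst sum.UNION_disjoint) auto
  also have "(\<Sum>e\<in>(\<Union>T\<in>triangles G. C T). \<psi> e) = (\<Sum>T\<in>triangles G. \<Sum>a\<in>T. 2 * \<phi> (4 * D a) (4 + D a))"
    using fT fC CC sumC by (subst sum.UNION_disjoint) auto
  finally show ?thesis
    unfolding sumA sum_triangles_corners[OF G] H_def
    by (simp add: sum.distrib distrib_left)
qed

section \<open>The triangular mesh\<close>

lemma mesh_adj_iff:
  "mesh_adj (x, y, z) (x', y', z') \<longleftrightarrow>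
     x = Suc x' \<and> y' = Suc y \<and> z = z' \<or> x = Suc x' \<and> y = y' \<and> z' = Suc z \<or>
     x = x' \<and> y = Suc y' \<and> z' = Suc z \<or> x = x' \<and> y' = Suc y \<and> z = Suc z' \<or>
     x' = Suc x \<and> y = y' \<and> z = Suc z' \<or> x' = Suc x \<and> y = Suc y' \<and> z = z'"
proof -
  have "int a - int b = 1 \<longleftrightarrow> a = Suc b" "int a - int b = -1 \<longleftrightarrow> b = Suc a"
    "int a - int b = 0 \<longleftrightarrow> a = b" for a b
    by linarith+
  then show ?thesis
    unfolding mesh_adj_def by simp
qed

text \<open>Writing both ends over their coordinatewise minimum \<open>(i, j, k)\<close> avoids truncated subtraction.\<close>

lemma mesh_adj_cases:
  assumes "mesh_adj p q"
  obtains i j k where "p = (Suc i, j, k)" "q = (i, Suc j, k)"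
  | i j k where "p = (Suc i, j, k)" "q = (i, j, Suc k)"
  | i j k where "p = (i, Suc j, k)" "q = (i, j, Suc k)"
  | i j k where "p = (i, j, Suc k)" "q = (i, Suc j, k)"
  | i j k where "p = (i, j, Suc k)" "q = (Suc i, j, k)"
  | i j k where "p = (i, Suc j, k)" "q = (Suc i, j, k)"
  using assms by (cases p; cases q) (fastforce simp: mesh_adj_iff)

lemma verts_tri_mesh: "verts (tri_mesh r) = mesh_verts r"
  by (simp add: tri_mesh_def)

lemma edge_tri_mesh_iff:
  "{p, q} \<in> edges (tri_mesh r) \<longleftrightarrow> p \<in> mesh_verts r \<and> q \<in> mesh_verts r \<and> mesh_adj p q"
proof -
  have "mesh_adj p q \<longleftrightarrow> mesh_adj q p" for p q
    by (cases p; cases q) (auto simp: mesh_adj_iff)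
  moreover have "{p, q} \<in> edges (tri_mesh r) \<longleftrightarrow>
      (\<exists>p' q'. {p, q} = {p', q'} \<and> p' \<in> mesh_verts r \<and> q' \<in> mesh_verts r \<and> mesh_adj p' q')"
    unfolding tri_mesh_def ugraph.simps mem_Collect_eq ..
  ultimately show ?thesis
    by (metis doubleton_eq_iff)
qed

text \<open>The two kinds of unit triangles, indexed by the coordinatewise minimum of their corners.\<close>

fun up_triangle :: "nat \<times> nat \<times> nat \<Rightarrow> (nat \<times> nat \<times> nat) set" where
  "up_triangle (i, j, k) = {(Suc i, j, k), (i, Suc j, k), (i, j, Suc k)}"

fun down_triangle :: "nat \<times> nat \<times> nat \<Rightarrow> (nat \<times> nat \<times> nat) set" where
  "down_triangle (i, j, k) = {(i, Suc j, Suc k), (Suc i, j, Suc k), (Suc i, Suc j, k)}"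

lemma card_up_triangle: "card (up_triangle u) = 3"
  by (cases u) simp

lemma card_down_triangle: "card (down_triangle u) = 3"
  by (cases u) simp

lemma up_triangle_subset_iff: "up_triangle u \<subseteq> mesh_verts r \<longleftrightarrow> u \<in> mesh_verts (r - 1)"
  by (cases u) (auto simp: mesh_verts_def)

lemma down_triangle_subset_iff: "down_triangle u \<subseteq> mesh_verts r \<longleftrightarrow> u \<in> mesh_verts (r - 2)"
  by (cases u) (auto simp: mesh_verts_def)

fun meet :: "nat \<times> nat \<times> nat \<Rightarrow> nat \<times> nat \<times> nat \<Rightarrow> nat \<times> nat \<times> nat" where
  "meet (x, y, z) (x', y', z') = (min x x', min y y', min z z')"

text \<open>As the index of a unit triangle is the minimum of its corners, that minimum is the only candidate
  for three given points, and a case distinction over the directions of the edges suffices.\<close>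

lemma pairwise_adjacent_triple:
  assumes "mesh_adj a b" "mesh_adj b c" "mesh_adj a c"
  shows "{a, b, c} \<subseteq> up_triangle (meet a (meet b c)) \<or> {a, b, c} \<subseteq> down_triangle (meet a (meet b c))"
  using assms by - (erule mesh_adj_cases; erule mesh_adj_cases; clarsimp simp: mesh_adj_iff)

lemma triangles_tri_mesh:
  "triangles (tri_mesh r) = up_triangle ` mesh_verts (r - 1) \<union> down_triangle ` mesh_verts (r - 2)"
  (is "?L = ?U \<union> ?D")
proof (intro equalityI subsetI)
  fix T assume T: "T \<in> ?L"
  then obtain a b c where abc: "T = {a, b, c}" "a \<noteq> b" "a \<noteq> c" "b \<noteq> c"
    by (auto simp: triangles_def card_3_iff)
  define m where "m = meet a (meet b c)"
  have card: "card T = 3" and sub: "T \<subseteq> mesh_verts r"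
    using T by (auto simp: triangles_def verts_tri_mesh)
  have "mesh_adj a b" "mesh_adj b c" "mesh_adj a c"
    using T abc by (auto simp: triangles_def edge_tri_mesh_iff)
  then have "T \<subseteq> up_triangle m \<or> T \<subseteq> down_triangle m"
    unfolding m_def abc(1) by (rule pairwise_adjacent_triple)
  then have "T = up_triangle m \<or> T = down_triangle m"
    using card card_up_triangle[of m] card_down_triangle[of m] card_subset_eq card_ge_0_finite
    by (metis zero_less_numeral)
  then show "T \<in> ?U \<union> ?D"
    using sub up_triangle_subset_iff down_triangle_subset_iff by blast
next
  have clique: "{a, b} \<in> edges (tri_mesh r)"
    if "T \<subseteq> mesh_verts r" "T = up_triangle u \<or> T = down_triangle u" "a \<in> T" "b \<in> T" "a \<noteq> b"
    for T u a b
  proof -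
    have "mesh_adj a b"
      using that(2-5) by (cases u) (auto simp: mesh_adj_iff)
    then show ?thesis
      using that by (auto simp: edge_tri_mesh_iff)
  qed
  fix T assume "T \<in> ?U \<union> ?D"
  then obtain u where u: "T = up_triangle u \<or> T = down_triangle u" and sub: "T \<subseteq> mesh_verts r"
    using up_triangle_subset_iff down_triangle_subset_iff by blast
  have "card T = 3"
    using u card_up_triangle card_down_triangle by blast
  then show "T \<in> ?L"
    using clique[OF sub u] sub unfolding triangles_def verts_tri_mesh by blast
qed

text \<open>The sums of the coordinates over the corners recover the index, and modulo 3 they recover the kind
  of the triangle. This makes injectivity and disjointness a matter of arithmetic.\<close>

lemma coordinate_sums_triangle:
  "sum fst (up_triangle u) = 3 * fst u + 1" "sum (fst \<circ> snd) (up_triangle u) = 3 * fst (snd u) + 1"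
  "sum (snd \<circ> snd) (up_triangle u) = 3 * snd (snd u) + 1"
  "sum fst (down_triangle u) = 3 * fst u + 2" "sum (fst \<circ> snd) (down_triangle u) = 3 * fst (snd u) + 2"
  "sum (snd \<circ> snd) (down_triangle u) = 3 * snd (snd u) + 2"
  by (cases u; simp)+

lemma inj_up_triangle: "inj up_triangle"
proof (rule injI)
  fix u v assume *: "up_triangle u = up_triangle v"
  show "u = v"
    using coordinate_sums_triangle(1-3)[of u] coordinate_sums_triangle(1-3)[of v] unfolding *
    by (intro prod_eqI) simp_all
qed

lemma inj_down_triangle: "inj down_triangle"
proof (rule injI)
  fix u v assume *: "down_triangle u = down_triangle v"
  show "u = v"
    using coordinate_sums_triangle(4-6)[of u] coordinate_sums_triangle(4-6)[of v] unfolding *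
    by (intro prod_eqI) simp_all
qed

lemma up_triangle_neq_down_triangle: "up_triangle u \<noteq> down_triangle v"
proof
  assume *: "up_triangle u = down_triangle v"
  have "3 * fst u + 1 = 3 * fst v + 2"
    using coordinate_sums_triangle(1)[of u] coordinate_sums_triangle(4)[of v] unfolding * by simp
  then show False
    by presburger
qed

text \<open>The first three terms count the upward triangles through the vertex, the others the downward ones:
  the index is obtained by decreasing one coordinate and two coordinates, respectively.\<close>

lemma card_triangles_at:
  assumes "(x, y, z) \<in> mesh_verts r"
  shows "card {T \<in> triangles (tri_mesh r). (x, y, z) \<in> T} =
           of_bool (x > 0) + of_bool (y > 0) + of_bool (z > 0) +
           of_bool (y > 0 \<and> z > 0) + of_bool (x > 0 \<and> z > 0) + of_bool (x > 0 \<and> y > 0)"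
proof -
  let ?U = "{u \<in> mesh_verts (r - 1). (x, y, z) \<in> up_triangle u}"
  let ?D = "{u \<in> mesh_verts (r - 2). (x, y, z) \<in> down_triangle u}"
  have r: "r = Suc (x + y + z)"
    using assms by (simp add: mesh_verts_def)
  have U: "?U = (if x > 0 then {(x - 1, y, z)} else {}) \<union>
      ((if y > 0 then {(x, y - 1, z)} else {}) \<union> (if z > 0 then {(x, y, z - 1)} else {}))"
    by (auto simp: mesh_verts_def r)
  have D: "?D = (if y > 0 \<and> z > 0 then {(x, y - 1, z - 1)} else {}) \<union>
      ((if x > 0 \<and> z > 0 then {(x - 1, y, z - 1)} else {}) \<union>
       (if x > 0 \<and> y > 0 then {(x - 1, y - 1, z)} else {}))"
    by (auto simp: mesh_verts_def r)
  have fin: "finite ?U" "finite ?D"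
    unfolding U D by simp_all
  have "{T \<in> triangles (tri_mesh r). (x, y, z) \<in> T} = up_triangle ` ?U \<union> down_triangle ` ?D"
    by (auto simp: triangles_tri_mesh)
  moreover have "up_triangle ` ?U \<inter> down_triangle ` ?D = {}"
    using up_triangle_neq_down_triangle by blast
  ultimately have "card {T \<in> triangles (tri_mesh r). (x, y, z) \<in> T} = card ?U + card ?D"
    using fin inj_up_triangle inj_down_triangle
    by (simp add: card_Un_disjoint card_image inj_on_subset[OF _ subset_UNIV])
  moreover have "card ?U = of_bool (x > 0) + of_bool (y > 0) + of_bool (z > 0)"
    unfolding U by (cases x; cases y; cases z) simp_all
  moreover have "card ?D = of_bool (y > 0 \<and> z > 0) + of_bool (x > 0 \<and> z > 0) + of_bool (x > 0 \<and> y > 0)"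
    unfolding D by (cases x; cases y; cases z) simp_all
  ultimately show ?thesis
    by simp
qed

lemma mesh_neighbours:
  "{q. mesh_adj (x, y, z) q} =
     (if x > 0 then {(x - 1, Suc y, z), (x - 1, y, Suc z)} else {}) \<union>
     ((if y > 0 then {(Suc x, y - 1, z), (x, y - 1, Suc z)} else {}) \<union>
      (if z > 0 then {(Suc x, y, z - 1), (x, Suc y, z - 1)} else {}))" (is "?L = ?R")
proof
  show "?R \<subseteq> ?L"
    by (cases x; cases y; cases z; simp add: mesh_adj_iff)
  show "?L \<subseteq> ?R"
  proof
    fix q assume "q \<in> ?L"
    then have "mesh_adj (x, y, z) q" by simp
    then show "q \<in> ?R" by (rule mesh_adj_cases) simp_all
  qed
qed

lemma degree_tri_mesh:
  assumes "(x, y, z) \<in> mesh_verts r"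
  shows "degree (tri_mesh r) (x, y, z) = 2 * (of_bool (x > 0) + of_bool (y > 0) + of_bool (z > 0))"
proof -
  have "q \<in> mesh_verts r" if "mesh_adj (x, y, z) q" for q
    using that assms by (cases q) (auto simp: mesh_adj_iff mesh_verts_def)
  then have "{q. {(x, y, z), q} \<in> edges (tri_mesh r)} = {q. mesh_adj (x, y, z) q}"
    using assms edge_tri_mesh_iff by blast
  then have "degree (tri_mesh r) (x, y, z) = card {q. mesh_adj (x, y, z) q}"
    by (simp only: degree_eq_card_neighbours[OF simple_graph_tri_mesh])
  then show ?thesis
    unfolding mesh_neighbours by (cases x; cases y; cases z) simp_all
qed

lemma degree_THDN3_Old:
  assumes "(x, y, z) \<in> mesh_verts r"
  shows "degree (THDN3 r) (Old (x, y, z)) =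
    4 * (of_bool (x > 0) + of_bool (y > 0) + of_bool (z > 0)) +
    2 * (of_bool (y > 0 \<and> z > 0) + of_bool (x > 0 \<and> z > 0) + of_bool (x > 0 \<and> y > 0))"
  unfolding THDN3_def degree_Old[OF simple_graph_tri_mesh] degree_tri_mesh[OF assms] card_triangles_at[OF assms]
  by simp

text \<open>Every edge of the mesh is a side of exactly one upward triangle.\<close>

lemma sum_edges_tri_mesh:
  fixes g :: "(nat \<times> nat \<times> nat) set \<Rightarrow> real"
  shows "(\<Sum>e\<in>edges (tri_mesh r). g e) =
    (\<Sum>(i, j, k)\<in>mesh_verts (r - 1). g {(Suc i, j, k), (i, Suc j, k)} +
       g {(i, Suc j, k), (i, j, Suc k)} + g {(Suc i, j, k), (i, j, Suc k)})"
proof -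
  define M where "M = mesh_verts (r - 1)"
  define x y z :: "nat \<times> nat \<times> nat \<Rightarrow> (nat \<times> nat \<times> nat) set"
    where "x = (\<lambda>(i, j, k). {(Suc i, j, k), (i, Suc j, k)})"
      and "y = (\<lambda>(i, j, k). {(i, Suc j, k), (i, j, Suc k)})"
      and "z = (\<lambda>(i, j, k). {(Suc i, j, k), (i, j, Suc k)})"
  define X Y Z where "X = x ` M" and "Y = y ` M" and "Z = z ` M"
  have M: "(i, j, k) \<in> M \<longleftrightarrow> i + j + k + 2 = r" for i j k
    by (auto simp: M_def mesh_verts_def)
  have fin: "finite M"
    by (rule finite_subset[of _ "{..r} \<times> {..r} \<times> {..r}"]) (auto simp: M)
  have "e \<in> X \<union> Y \<union> Z" if "e \<in> edges (tri_mesh r)" for e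
  proof -
    obtain p q where e: "e = {p, q}" and p: "p \<in> mesh_verts r" and "mesh_adj p q"
      using \<open>e \<in> edges (tri_mesh r)\<close> by (auto simp: tri_mesh_def)
    have X: "{(Suc i, j, k), (i, Suc j, k)} \<in> X" "{(i, Suc j, k), (Suc i, j, k)} \<in> X"
      and Y: "{(i, Suc j, k), (i, j, Suc k)} \<in> Y" "{(i, j, Suc k), (i, Suc j, k)} \<in> Y"
      and Z: "{(Suc i, j, k), (i, j, Suc k)} \<in> Z" "{(i, j, Suc k), (Suc i, j, k)} \<in> Z"
      if "i + j + k + 2 = r" for i j k
      using that unfolding X_def Y_def Z_def x_def y_def z_def
      by (auto simp: M intro!: image_eqI[of _ _ "(i, j, k)"])
    from \<open>mesh_adj p q\<close> show ?thesis
    proof (rule mesh_adj_cases)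
    qed (use p in \<open>simp_all add: mesh_verts_def e X Y Z\<close>)
  qed
  moreover have "X \<union> Y \<union> Z \<subseteq> edges (tri_mesh r)"
    by (auto simp: X_def Y_def Z_def x_def y_def z_def M edge_tri_mesh_iff mesh_adj_iff mesh_verts_def)
  ultimately have E: "edges (tri_mesh r) = X \<union> (Y \<union> Z)"
    by auto
  \<comment> \<open>Over the two ends of a side, two of the three coordinate sums are odd and the third is even. Halving
     them recovers the index of the triangle, and the place of the even one tells which side it is.\<close>
  let ?c = "\<lambda>e. (sum fst e div 2, sum (fst \<circ> snd) e div 2, sum (snd \<circ> snd) e div 2)"
  have inj: "inj_on x M" "inj_on y M" "inj_on z M"
    by (rule inj_on_inverseI[where g = ?c], simp add: x_def y_def z_def split: prod.splits)+
  have "even (sum (snd \<circ> snd) e)" if "e \<in> X" for e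
    using that by (auto simp: X_def x_def)
  moreover have "even (sum fst e)" "odd (sum (snd \<circ> snd) e)" if "e \<in> Y" for e
    using that by (auto simp: Y_def y_def)
  moreover have "odd (sum fst e)" "odd (sum (snd \<circ> snd) e)" if "e \<in> Z" for e
    using that by (auto simp: Z_def z_def)
  ultimately have disj: "X \<inter> (Y \<union> Z) = {}" "Y \<inter> Z = {}"
    by blast+
  have finite: "finite X" "finite Y" "finite Z"
    using fin by (simp_all add: X_def Y_def Z_def)
  have "sum g (edges (tri_mesh r)) = sum g X + (sum g Y + sum g Z)"
    unfolding E using finite disj by (simp add: sum.union_disjoint)
  also have "\<dots> = (\<Sum>u\<in>M. g (x u)) + ((\<Sum>u\<in>M. g (y u)) + (\<Sum>u\<in>M. g (z u)))"
    unfolding X_def Y_def Z_def using inj by (simp add: sum.reindex)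
  finally show ?thesis
    by (simp add: M_def x_def y_def z_def case_prod_unfold sum.distrib)
qed

text \<open>A triangle with \<open>n + 1\<close> vertices on each side has \<open>(n - 1) (n - 2) / 2\<close> interior vertices, \<open>n - 1\<close>
  vertices inside each side and three corners. The induction removes the side \<open>x = 0\<close>. What is left is a
  smaller triangle in which the first coordinate never vanishes, so the induction hypothesis is
  needed for the pattern function \<open>\<lambda>_. W False\<close>.\<close>

lemma sum_zero_pattern:
  fixes W :: "bool \<Rightarrow> bool \<Rightarrow> bool \<Rightarrow> real"
  assumes "n \<ge> 1"
  shows "(\<Sum>(x, y, z)\<in>mesh_verts (Suc n). W (x = 0) (y = 0) (z = 0)) =
    (real n - 1) * (real n - 2) / 2 * W False False False +
    (real n - 1) * (W True False False + W False True False + W False False True) +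
    W True True False + W True False True + W False True True"
  using assms
proof (induction n arbitrary: W rule: dec_induct)
  case base
  have "mesh_verts (Suc 1) = {(1, 0, 0), (0, 1, 0), (0, 0, 1)}"
    by (auto simp: mesh_verts_def)
  then show ?case
    by simp
next
  case (step n)
  let ?up = "(\<lambda>(x, y, z). (Suc x, y, z)) ` mesh_verts (Suc n)"
  let ?line = "(\<lambda>y. (0::nat, y, Suc n - y)) ` {..Suc n}"
  have split: "mesh_verts (Suc (Suc n)) = ?up \<union> ?line"
  proof (intro equalityI subsetI)
    fix p assume "p \<in> mesh_verts (Suc (Suc n))"
    then obtain x y z where p: "p = (x, y, z)" and s: "x + y + z = Suc n"
      by (auto simp: mesh_verts_def)
    show "p \<in> ?up \<union> ?line"
    proof (cases x)
      case 0
      then have "p = (0, y, Suc n - y)" "y \<le> Suc n"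
        using p s by auto
      then show ?thesis by blast
    next
      case (Suc x')
      then have "(x', y, z) \<in> mesh_verts (Suc n)"
        using s by (simp add: mesh_verts_def)
      then show ?thesis
        using p Suc by force
    qed
  qed (auto simp: mesh_verts_def)
  have "finite (mesh_verts (Suc n))"
    using simple_graph_tri_mesh[of "Suc n"] by (simp add: simple_graph_def verts_tri_mesh)
  then have "(\<Sum>(x, y, z)\<in>mesh_verts (Suc (Suc n)). W (x = 0) (y = 0) (z = 0)) =
      (\<Sum>(x, y, z)\<in>?up. W (x = 0) (y = 0) (z = 0)) + (\<Sum>(x, y, z)\<in>?line. W (x = 0) (y = 0) (z = 0))"
    unfolding split by (intro sum.union_disjoint) auto
  also have "(\<Sum>(x, y, z)\<in>?up. W (x = 0) (y = 0) (z = 0)) =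
      (\<Sum>(x, y, z)\<in>mesh_verts (Suc n). W False (y = 0) (z = 0))"
    by (subst sum.reindex) (auto simp: inj_on_def case_prod_unfold)
  also have "(\<Sum>(x, y, z)\<in>?line. W (x = 0) (y = 0) (z = 0)) =
      (\<Sum>y\<le>Suc n. W True (y = 0) (Suc n - y = 0))"
    by (subst sum.reindex) (auto simp: inj_on_def)
  also have "\<dots> = W True True False + real n * W True False False + W True False True"
  proof -
    have "(\<Sum>y\<le>Suc n. g y) = g 0 + (\<Sum>y<n. g (Suc y)) + g (Suc n)" for g :: "nat \<Rightarrow> real"
      by (induction n) simp_all
    then show ?thesis
      by simp
  qed
  finally show ?case
    unfolding step.IH[of "\<lambda>_. W False"] by (simp add: field_simps)
qed

section \<open>The indices of the network\<close>

text \<open>The coefficients are the numbers of edges with end degrees (4, 4), (4, 10), (4, 18), (10, 10), (10, 18)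
  and (18, 18), in this order. The bound on \<open>r\<close> ensures that the upward triangles are indexed by a mesh with
  at least two vertices on each side, as \<open>sum_zero_pattern\<close> demands.\<close>

lemma zagreb_sum_THDN3:
  assumes "r \<ge> 3"
  shows "zagreb_sum \<phi> (THDN3 r) =
    (3 * (real r - 1)\<^sup>2 + 6) * \<phi> 16 8 +
    (18 * (real r - 2) + 6) * \<phi> 40 14 +
    6 * (real r - 2) * (real r - 3) * \<phi> 72 22 +
    3 * (real r - 2) * \<phi> 100 20 +
    6 * (real r - 3) * \<phi> 180 28 +
    3 * (real r - 3) * (real r - 4) / 2 * \<phi> 324 36"
proof -
  define D where "D p = real (degree (THDN3 r) (Old p))" for p
  \<comment> \<open>\<open>d\<close> and \<open>t\<close> are the degree in the network and the number of triangles as functions of the zero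
     pattern of a mesh vertex.\<close>
  define d :: "bool \<Rightarrow> bool \<Rightarrow> bool \<Rightarrow> real" where
    "d a b c = 4 * (of_bool (\<not> a) + of_bool (\<not> b) + of_bool (\<not> c)) +
       2 * (of_bool (\<not> b \<and> \<not> c) + of_bool (\<not> a \<and> \<not> c) + of_bool (\<not> a \<and> \<not> b))" for a b c
  define t :: "bool \<Rightarrow> bool \<Rightarrow> bool \<Rightarrow> real" where
    "t a b c = of_bool (\<not> a) + of_bool (\<not> b) + of_bool (\<not> c) +
       of_bool (\<not> b \<and> \<not> c) + of_bool (\<not> a \<and> \<not> c) + of_bool (\<not> a \<and> \<not> b)" for a b c
  have D: "D (x, y, z) = d (x = 0) (y = 0) (z = 0)" if "x + y + z + 1 = r" for x y z
    using that by (simp add: D_def d_def degree_THDN3_Old mesh_verts_def)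
  have "(\<Sum>p\<in>mesh_verts r. real (card {T \<in> triangles (tri_mesh r). p \<in> T}) *
        (\<phi> 16 8 + 2 * \<phi> (4 * D p) (4 + D p))) =
      (\<Sum>(x, y, z)\<in>mesh_verts (Suc (r - 1)). t (x = 0) (y = 0) (z = 0) *
        (\<phi> 16 8 + 2 * \<phi> (4 * d (x = 0) (y = 0) (z = 0)) (4 + d (x = 0) (y = 0) (z = 0))))"
    using assms D
    by (intro sum.cong) (auto simp: card_triangles_at t_def mesh_verts_def)
  also have "\<dots> = (real r - 2) * (real r - 3) / 2 * (6 * \<phi> 16 8 + 12 * \<phi> 72 22) +
      (real r - 2) * (9 * \<phi> 16 8 + 18 * \<phi> 40 14) + 9 * \<phi> 16 8"
    using assms
    by (subst sum_zero_pattern[where W = "\<lambda>a b c. t a b c * (\<phi> 16 8 + 2 * \<phi> (4 * d a b c) (4 + d a b c))"])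
      (simp_all add: t_def d_def of_nat_diff field_simps)
  finally have V: "(\<Sum>p\<in>verts (tri_mesh r). real (card {T \<in> triangles (tri_mesh r). p \<in> T}) *
        (\<phi> 16 8 + 2 * \<phi> (4 * D p) (4 + D p))) = \<dots>"
    by (simp add: verts_tri_mesh)
  define w where "w p q = \<phi> (p * q) (p + q)" for p q
  \<comment> \<open>A corner of the upward triangle \<open>(i, j, k)\<close> has one coordinate increased, hence nonzero, while the
     other two vanish exactly when they do in the index.\<close>
  have "(\<Sum>e\<in>edges (tri_mesh r). \<phi> (\<Prod>p\<in>e. D p) (\<Sum>p\<in>e. D p)) =
      (\<Sum>(i, j, k)\<in>mesh_verts (Suc (r - 2)).
         w (d False (j = 0) (k = 0)) (d (i = 0) False (k = 0)) +
         w (d (i = 0) False (k = 0)) (d (i = 0) (j = 0) False) +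
         w (d False (j = 0) (k = 0)) (d (i = 0) (j = 0) False))"
    unfolding sum_edges_tri_mesh
    using assms by (intro sum.cong) (auto simp: mesh_verts_def D w_def)
  also have "\<dots> = (real r - 3) * (real r - 4) / 2 * (3 * \<phi> 324 36) +
      (real r - 3) * (3 * \<phi> 100 20 + 6 * \<phi> 180 28) + 3 * \<phi> 100 20 + 6 * \<phi> 40 14"
    using assms
    by (subst sum_zero_pattern[where W = "\<lambda>a b c. w (d False b c) (d a False c) +
         w (d a False c) (d a b False) + w (d False b c) (d a b False)"])
      (simp_all add: d_def w_def of_nat_diff field_simps)
  finally show ?thesis
    using V zagreb_sum_octahedral_replacement[OF simple_graph_tri_mesh, of \<phi> r]
    unfolding D_def THDN3_def
    by (simp add: algebra_simps power2_eq_square add_divide_distrib diff_divide_distrib)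
qed

theorem theorem2p2p3:
  fixes r :: nat
  assumes "r \<ge> 4"
  shows "ReZG1 (THDN3 r) = 3 / 154 * (3408 - 5117 * real r + 2009 * (real r)\<^sup>2) \<and>
         ReZG2 (THDN3 r) = 1 / 2 * (6 - 11 * real r + 7 * (real r)\<^sup>2) \<and>
         ReZG3 (THDN3 r) = 24 * (6192 - 5185 * real r + 1141 * (real r)\<^sup>2)"
proof -
  have r: "r \<ge> 3"
    using assms by simp
  have "ReZG1 (THDN3 r) = zagreb_sum (\<lambda>p s. p / s) (THDN3 r)"
    "ReZG2 (THDN3 r) = zagreb_sum (\<lambda>p s. s / p) (THDN3 r)"
    "ReZG3 (THDN3 r) = zagreb_sum (\<lambda>p s. p * s) (THDN3 r)"
    by (simp_all add: ReZG1_def ReZG2_def ReZG3_def zagreb_sum_def)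
  then show ?thesis
    unfolding zagreb_sum_THDN3[OF r] by (simp add: field_simps power2_eq_square)
qed

end
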